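(* Let $M$ be a $\mathbb{Z}_{\geq 0}$-semimodule. Then the following conditions are equivalent: (i) $M$ is minimal; (ii) $M$ is elementary; (iii) $M$ is simple; (iv) $M$ is isomorphic either to $\mathbf{B}$ or to $\mathbb{Z}_p$, for some prime $p$.
   Context: A semiring is a tuple $(R,+,\cdot,0,1)$ where $(R,+,0)$ is a commutative monoid, $(R,\cdot,1)$ is a monoid, multiplication distributes over addition on both sides, and $0a=a0=0$ for all $a\in R$. A (left) $R$-semimodule is a commutative monoid $(M,+,0_M)$ with a map $R\times M\to M$, $(r,m)\mapsto r(m)$, such that $r(m+n)=r(m)+r(n)$, $r(0_M)=0_M$, $(r+s)(m)=r(m)+s(m)$, $(rs)(m)=r(s(m))$, $0(m)=0_M$, $1(m)=m$. Homomorphisms of semimodules are monoid homomorphisms commuting with the action of $R$. A subsemimodule is a submonoid closed under the action of $R$. An $R$-congruence on $M$ is an equivalence relation $\sim$ such that $m\sim n$ implies $m+k\sim n+k$ for all $k\in M$ and $r(m)\sim r(n)$ for all $r\in R$. A non-zero $R$-semimodule $M$ is called minimal if its only subsemimodules are $\{0_M\}$ and $M$; elementary if its only $R$-congruences are the equality relation and the full relation $M\times M$; simple if it is both minimal and elementary. $\mathbb{Z}_{\geq 0}$ is the semiring of non-negative integers with usual addition and multiplication. Every commutative monoid has a unique structure of a $\mathbb{Z}_{\geq 0}$-semimodule ($i(m)$ is the $i$-fold sum of $m$). $\mathbf{B}$ denotes the commutative monoid $(\{0,1\},+,0)$ with $1+1=1$, and $\mathbb{Z}_p$ the additive group of integers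 modulo $p$, both with this $\mathbb{Z}_{\geq 0}$-semimodule structure. *)

theory Defs
  imports "HOL-Algebra.Module" "HOL-Number_Theory.Residues"
begin

section \<open>Semimodules over a semiring\<close>

text \<open>As for modules in HOL-Algebra, a semimodule is given by a record of type \<open>module\<close>, whose
  ring multiplication and ring unit fields are irrelevant.\<close>

locale semimodule = R?: semiring R + M?: abelian_monoid M
  for R :: "('a, 'r) ring_scheme" and M :: "('a, 'b, 'm) module_scheme" (structure) +
  assumes smult_closed [simp, intro]:
      "\<lbrakk>r \<in> carrier R; m \<in> carrier M\<rbrakk> \<Longrightarrow> r \<odot> m \<in> carrier M"
    and smult_r_distr:
      "\<lbrakk>r \<in> carrier R; m \<in> carrier M; n \<in> carrier M\<rbrakk> \<Longrightarrow> r \<odot> (m \<oplus> n) = r \<odot> m \<oplus> r \<odot> n"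
    and smult_r_null [simp]:
      "r \<in> carrier R \<Longrightarrow> r \<odot> \<zero> = \<zero>"
    and smult_l_distr:
      "\<lbrakk>r \<in> carrier R; s \<in> carrier R; m \<in> carrier M\<rbrakk> \<Longrightarrow> (r \<oplus>\<^bsub>R\<^esub> s) \<odot> m = r \<odot> m \<oplus> s \<odot> m"
    and smult_assoc1:
      "\<lbrakk>r \<in> carrier R; s \<in> carrier R; m \<in> carrier M\<rbrakk> \<Longrightarrow> (r \<otimes>\<^bsub>R\<^esub> s) \<odot> m = r \<odot> (s \<odot> m)"
    and smult_l_null [simp]:
      "m \<in> carrier M \<Longrightarrow> \<zero>\<^bsub>R\<^esub> \<odot> m = \<zero>"
    and smult_one [simp]:
      "m \<in> carrier M \<Longrightarrow> \<one>\<^bsub>R\<^esub> \<odot> m = m"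

definition semimodule_hom ::
  "[('a, 'r) ring_scheme, ('a, 'b, 'm) module_scheme, ('a, 'c, 'n) module_scheme] \<Rightarrow> ('b \<Rightarrow> 'c) set"
  where "semimodule_hom R M N =
    {h \<in> hom (add_monoid M) (add_monoid N).
      h \<zero>\<^bsub>M\<^esub> = \<zero>\<^bsub>N\<^esub> \<and>
      (\<forall>r\<in>carrier R. \<forall>m\<in>carrier M. h (r \<odot>\<^bsub>M\<^esub> m) = r \<odot>\<^bsub>N\<^esub> h m)}"

definition semimodule_isomorphic ::
  "[('a, 'r) ring_scheme, ('a, 'b, 'm) module_scheme, ('a, 'c, 'n) module_scheme] \<Rightarrow> bool"
  where "semimodule_isomorphic R M N \<longleftrightarrow>
    (\<exists>h\<in>semimodule_hom R M N. bij_betw h (carrier M) (carrier N))"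

locale subsemimodule = submonoid H "add_monoid M"
  for H and R :: "('a, 'r) ring_scheme" and M :: "('a, 'b, 'm) module_scheme" (structure) +
  assumes smult_closed [simp, intro]: "\<lbrakk>r \<in> carrier R; m \<in> H\<rbrakk> \<Longrightarrow> r \<odot> m \<in> H"

definition semimodule_congruence ::
  "[('a, 'r) ring_scheme, ('a, 'b, 'm) module_scheme, ('b \<times> 'b) set] \<Rightarrow> bool"
  where "semimodule_congruence R M C \<longleftrightarrow>
    equiv (carrier M) C \<and>
    (\<forall>(m, n)\<in>C. \<forall>k\<in>carrier M. (m \<oplus>\<^bsub>M\<^esub> k, n \<oplus>\<^bsub>M\<^esub> k) \<in> C) \<and>
    (\<forall>(m, n)\<in>C. \<forall>r\<in>carrier R. (r \<odot>\<^bsub>M\<^esub> m, r \<odot>\<^bsub>M\<^esub> n) \<in> C)"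

locale nonzero_semimodule = semimodule +
  assumes nonzero: "carrier M \<noteq> {\<zero>}"

locale minimal_semimodule = nonzero_semimodule +
  assumes minimal: "subsemimodule H R M \<Longrightarrow> H = {\<zero>} \<or> H = carrier M"

locale elementary_semimodule = nonzero_semimodule +
  assumes elementary:
    "semimodule_congruence R M C \<Longrightarrow> C = Id_on (carrier M) \<or> C = carrier M \<times> carrier M"

locale simple_semimodule = minimal_semimodule + elementary_semimodule


section \<open>Semimodules over the non-negative integers\<close>

definition nat_semiring :: "nat ring"
  where "nat_semiring = \<lparr>carrier = UNIV, monoid.mult = (*), one = 1, zero = 0, add = (+)\<rparr>"

text \<open>The canonical semimodule structure on the additive monoid of \<open>G\<close>; \<open>[i] \<cdot>\<^bsub>G\<^esub> m\<close> is the
  \<open>i\<close>-fold sum of \<open>m\<close>.\<close>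

definition nat_semimodule :: "('b, 'm) ring_scheme \<Rightarrow> (nat, 'b) module"
  where "nat_semimodule G =
    \<lparr>carrier = carrier G, monoid.mult = monoid.mult G, one = one G, zero = zero G, add = add G,
     smult = \<lambda>i m. [i] \<cdot>\<^bsub>G\<^esub> m\<rparr>"

text \<open>On \<open>{0, 1}\<close>, \<open>max\<close> is the addition with \<open>1 + 1 = 1\<close>.\<close>

definition boolean_semiring :: "nat ring"
  where "boolean_semiring =
    \<lparr>carrier = {0, 1}, monoid.mult = min, one = 1, zero = 0, add = max\<rparr>"

definition B_semimodule :: "(nat, nat) module"
  where "B_semimodule = nat_semimodule boolean_semiring"

definition Z_semimodule :: "nat \<Rightarrow> (nat, int) module"
  where "Z_semimodule p = nat_semimodule (residue_ring (int p))"

lemma semiring_nat_semiring: "semiring nat_semiring"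
  unfolding nat_semiring_def by unfold_locales (auto simp: algebra_simps)

lemma semimodule_nat_semimodule:
  assumes "abelian_monoid G"
  shows "semimodule nat_semiring (nat_semimodule G)"
proof -
  interpret G: abelian_monoid G by (fact assms)
  interpret S: semiring nat_semiring by (fact semiring_nat_semiring)
  have M: "abelian_monoid (nat_semimodule G)"
    by (intro abelian_monoidI) (auto simp: nat_semimodule_def G.a_ac)
  interpret M: abelian_monoid "nat_semimodule G" by (fact M)
  show ?thesis
    by unfold_locales
      (auto simp: nat_semimodule_def nat_semiring_def G.add.nat_pow_mult G.add.nat_pow_distrib
        G.add.nat_pow_pow mult.commute)
qed

lemma semimodule_B: "semimodule nat_semiring B_semimodule"
  unfolding B_semimodule_def
  by (rule semimodule_nat_semimodule, rule abelian_monoidI) (auto simp: boolean_semiring_def)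

lemma semimodule_Z:
  assumes "p > 1"
  shows "semimodule nat_semiring (Z_semimodule p)"
proof -
  interpret residues "int p" "residue_ring (int p)"
    using assms by unfold_locales auto
  show ?thesis
    unfolding Z_semimodule_def by (rule semimodule_nat_semimodule) unfold_locales
qed

end

theory Submission
  imports Defs
begin

text \<open>
  The action of the semiring of natural numbers is iterated addition, so submonoids and translation
  invariant equivalences are already subsemimodules and congruences, and everything is a
  question about commutative monoids.

  Minimality says that every non-zero element \<open>m\<close> generates \<open>M\<close>. If \<open>2m \<noteq> 0\<close>, then \<open>m\<close>
  itself is a multiple \<open>2km\<close> of \<open>2m\<close>, and \<open>(2k - 1)m\<close> is idempotent. A non-zero idempotent \<open>e\<close>
  generates only \<open>{0, e}\<close>, which is \<open>\<^bold>B\<close>; otherwise a positive multiple of \<open>m\<close> vanishes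
  (lemma \<open>minimal_idempotent_or_torsion\<close>), so \<open>M\<close> is a cyclic group, and its
  order is prime because every non-zero element generates it. Conversely \<open>\<^bold>B\<close> and the groups of
  prime order are minimal, and minimality is invariant under isomorphism.

  To compare minimality with elementarity, two congruences on \<open>M\<close> suffice. The first
  has the invertible elements as one class and the others as a second class; on an elementary
  \<open>M\<close> it forces \<open>M\<close> to have two elements or to be a group. The second is, for a submonoid \<open>H\<close>,
  the relation \<open>\<exists>h h'\<in>H. x + h = y + h'\<close>; on an elementary group, for \<open>H\<close> non-zero,
  it writes every element as a difference of elements of \<open>H\<close>, and applied to the multiples
  of \<open>2h\<close> it shows that \<open>h\<close> has finite order, so that differences of elements of \<open>H\<close> stay in \<open>H\<close>.
  In the other direction, a congruence on a group is determined by the class of \<open>0\<close>, and this class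
  is a submonoid.
\<close>

section \<open>Isomorphisms of semimodules\<close>

lemma (in semimodule) subsemimoduleI:
  assumes "H \<subseteq> carrier M" "\<zero> \<in> H"
    and "\<And>x y. x \<in> H \<Longrightarrow> y \<in> H \<Longrightarrow> x \<oplus> y \<in> H"
    and "\<And>r x. r \<in> carrier R \<Longrightarrow> x \<in> H \<Longrightarrow> r \<odot> x \<in> H"
  shows "subsemimodule H R M"
  by unfold_locales (use assms in auto)

lemma subsemimoduleD:
  assumes "subsemimodule H R M"
  shows "H \<subseteq> carrier M" "\<zero>\<^bsub>M\<^esub> \<in> H"
    and "\<And>x y. x \<in> H \<Longrightarrow> y \<in> H \<Longrightarrow> x \<oplus>\<^bsub>M\<^esub> y \<in> H"
    and "\<And>r x. r \<in> carrier R \<Longrightarrow> x \<in> H \<Longrightarrow> r \<odot>\<^bsub>M\<^esub> x \<in> H"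
proof -
  interpret subsemimodule H R M by (fact assms)
  show "H \<subseteq> carrier M" "\<zero>\<^bsub>M\<^esub> \<in> H"
    and "\<And>x y. x \<in> H \<Longrightarrow> y \<in> H \<Longrightarrow> x \<oplus>\<^bsub>M\<^esub> y \<in> H"
    and "\<And>r x. r \<in> carrier R \<Longrightarrow> x \<in> H \<Longrightarrow> r \<odot>\<^bsub>M\<^esub> x \<in> H"
    using subset one_closed m_closed smult_closed by auto
qed

lemma semimodule_homD:
  assumes "h \<in> semimodule_hom R M N"
  shows "\<And>x. x \<in> carrier M \<Longrightarrow> h x \<in> carrier N"
    and "\<And>x y. x \<in> carrier M \<Longrightarrow> y \<in> carrier M \<Longrightarrow> h (x \<oplus>\<^bsub>M\<^esub> y) = h x \<oplus>\<^bsub>N\<^esub> h y"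
    and "h \<zero>\<^bsub>M\<^esub> = \<zero>\<^bsub>N\<^esub>"
    and "\<And>r x. r \<in> carrier R \<Longrightarrow> x \<in> carrier M \<Longrightarrow> h (r \<odot>\<^bsub>M\<^esub> x) = r \<odot>\<^bsub>N\<^esub> h x"
  using assms by (auto simp: semimodule_hom_def hom_def)

lemma semimodule_isomorphic_sym:
  assumes "semimodule R M" and "semimodule_isomorphic R M N"
  shows "semimodule_isomorphic R N M"
proof -
  interpret semimodule R M by (fact assms(1))
  obtain h where h: "h \<in> semimodule_hom R M N" and bij: "bij_betw h (carrier M) (carrier N)"
    using assms(2) by (auto simp: semimodule_isomorphic_def)
  note hom = semimodule_homD[OF h]
  define g where "g = inv_into (carrier M) h"
  have gh: "g (h x) = x" if "x \<in> carrier M" for x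
    using that bij by (simp add: g_def bij_betw_inv_into_left)
  have ex: "\<exists>x\<in>carrier M. y = h x" if "y \<in> carrier N" for y
    using that bij by (auto simp: bij_betw_def)
  have hg: "g y \<in> carrier M \<and> h (g y) = y" if "y \<in> carrier N" for y
    using ex[OF that] gh by auto
  have "g (x \<oplus>\<^bsub>N\<^esub> y) = g x \<oplus>\<^bsub>M\<^esub> g y" if "x \<in> carrier N" "y \<in> carrier N" for x y
    using gh[of "g x \<oplus>\<^bsub>M\<^esub> g y"] hg that hom(2) by auto
  moreover have "g (r \<odot>\<^bsub>N\<^esub> y) = r \<odot>\<^bsub>M\<^esub> g y" if "r \<in> carrier R" "y \<in> carrier N" for r y
    using gh[of "r \<odot>\<^bsub>M\<^esub> g y"] hg that hom(4) by auto
  moreover have "g \<zero>\<^bsub>N\<^esub> = \<zero>\<^bsub>M\<^esub>"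
    using gh[of "\<zero>\<^bsub>M\<^esub>"] hom(3) by auto
  ultimately have "g \<in> semimodule_hom R N M"
    using hg by (auto simp: semimodule_hom_def hom_def)
  moreover have "bij_betw g (carrier N) (carrier M)"
    unfolding g_def by (rule bij_betw_inv_into[OF bij])
  ultimately show ?thesis
    by (auto simp: semimodule_isomorphic_def)
qed

lemma minimal_semimodule_isomorphic:
  assumes M: "semimodule R M" and N: "minimal_semimodule R N"
    and iso: "semimodule_isomorphic R M N"
  shows "minimal_semimodule R M"
proof -
  interpret M: semimodule R M by (fact M)
  interpret N: minimal_semimodule R N by (fact N)
  obtain h where h: "h \<in> semimodule_hom R M N" and bij: "bij_betw h (carrier M) (carrier N)"
    using iso by (auto simp: semimodule_isomorphic_def)
  note hom = semimodule_homD[OF h]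
  have inj: "inj_on h (carrier M)" and img: "h ` carrier M = carrier N"
    using bij by (auto simp: bij_betw_def)
  have zero: "h ` {\<zero>\<^bsub>M\<^esub>} = {\<zero>\<^bsub>N\<^esub>}"
    by (simp add: hom)
  show ?thesis
  proof
    show "carrier M \<noteq> {\<zero>\<^bsub>M\<^esub>}"
      using N.nonzero img zero by metis
  next
    fix H assume H: "subsemimodule H R M"
    note D = subsemimoduleD[OF H]
    have "subsemimodule (h ` H) R N"
    proof (rule N.subsemimoduleI)
      show "h ` H \<subseteq> carrier N"
        using D(1) hom(1) by auto
      show "\<zero>\<^bsub>N\<^esub> \<in> h ` H"
        using D(2) hom(3) by (metis imageI)
      show "x \<oplus>\<^bsub>N\<^esub> y \<in> h ` H" if "x \<in> h ` H" "y \<in> h ` H" for x y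
        using that D(1,3) hom(2) by (smt (verit) imageE imageI subsetD)
      show "r \<odot>\<^bsub>N\<^esub> x \<in> h ` H" if "r \<in> carrier R" "x \<in> h ` H" for r x
        using that D(1,4) hom(4) by (smt (verit) imageE imageI subsetD)
    qed
    then have "h ` H = h ` {\<zero>\<^bsub>M\<^esub>} \<or> h ` H = h ` carrier M"
      using N.minimal img zero by metis
    then show "H = {\<zero>\<^bsub>M\<^esub>} \<or> H = carrier M"
      using inj_on_image_eq_iff[OF inj D(1)] by (metis M.zero_closed empty_subsetI insert_subset
          order_refl)
  qed
qed


section \<open>Commutative monoids as semimodules\<close>

locale nat_module = semimodule nat_semiring M
  for M :: "(nat, 'b, 'm) module_scheme" (structure)
begin

lemma smult_nat_closed [simp]: "x \<in> carrier M \<Longrightarrow> i \<odot> x \<in> carrier M"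
  using smult_closed[of i x] by (simp add: nat_semiring_def)

lemma smult_nat_0 [simp]: "x \<in> carrier M \<Longrightarrow> 0 \<odot> x = \<zero>"
  using smult_l_null by (simp add: nat_semiring_def)

lemma smult_nat_1 [simp]: "x \<in> carrier M \<Longrightarrow> Suc 0 \<odot> x = x"
  using smult_one by (simp add: nat_semiring_def)

lemma smult_nat_zero [simp]: "i \<odot> \<zero> = \<zero>"
  using smult_r_null by (simp add: nat_semiring_def)

lemma smult_nat_add: "x \<in> carrier M \<Longrightarrow> (i + j) \<odot> x = i \<odot> x \<oplus> j \<odot> x"
  using smult_l_distr[of i j x] by (simp add: nat_semiring_def)

lemma smult_nat_mult: "x \<in> carrier M \<Longrightarrow> (i * j) \<odot> x = i \<odot> (j \<odot> x)"
  using smult_assoc1[of i j x] by (simp add: nat_semiring_def)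

lemma smult_nat_Suc: "x \<in> carrier M \<Longrightarrow> Suc i \<odot> x = x \<oplus> i \<odot> x"
  using smult_nat_add[of x 1 i] by simp

lemma submonoid_imp_subsemimodule:
  assumes "H \<subseteq> carrier M" "\<zero> \<in> H"
    and "\<And>x y. x \<in> H \<Longrightarrow> y \<in> H \<Longrightarrow> x \<oplus> y \<in> H"
  shows "subsemimodule H nat_semiring M"
proof (rule subsemimoduleI)
  show "i \<odot> x \<in> H" if "x \<in> H" for i x
    using that assms by (induction i) (auto simp: smult_nat_Suc subset_iff)
qed (use assms in auto)

lemma subsemimodule_multiples:
  assumes "m \<in> carrier M"
  shows "subsemimodule (range (\<lambda>i. i \<odot> m)) nat_semiring M"
proof (rule submonoid_imp_subsemimodule)
  show "\<zero> \<in> range (\<lambda>i. i \<odot> m)"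
    using assms by (metis rangeI smult_nat_0)
qed (use assms in \<open>auto simp flip: smult_nat_add\<close>)

lemma translation_invariant_imp_congruence:
  assumes eq: "equiv (carrier M) C"
    and add: "\<And>x y k. (x, y) \<in> C \<Longrightarrow> k \<in> carrier M \<Longrightarrow> (x \<oplus> k, y \<oplus> k) \<in> C"
  shows "semimodule_congruence nat_semiring M C"
proof -
  have sub: "C \<subseteq> carrier M \<times> carrier M" and tr: "trans C" and rf: "refl_on (carrier M) C"
    using eq by (auto simp: equiv_def)
  have "(i \<odot> x, i \<odot> y) \<in> C" if xy: "(x, y) \<in> C" for x y i
  proof (induction i)
    case 0
    show ?case
      using xy sub rf by (auto simp: refl_on_def)
  next
    case (Suc i)
    have c: "x \<in> carrier M" "y \<in> carrier M"
      using xy sub by auto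
    have "(x \<oplus> i \<odot> x, y \<oplus> i \<odot> x) \<in> C" and "(i \<odot> x \<oplus> y, i \<odot> y \<oplus> y) \<in> C"
      using add xy Suc c by auto
    then show ?case
      using tr c by (auto simp: smult_nat_Suc M.a_comm dest: transD)
  qed
  then show ?thesis
    using eq add by (auto simp: semimodule_congruence_def)
qed


section \<open>Minimal and elementary semimodules\<close>

text \<open>The multiples of \<open>m\<close> form a subsemimodule that contains \<open>m\<close>.\<close>

lemma minimal_generates:
  assumes "minimal_semimodule nat_semiring M" "m \<in> carrier M" "m \<noteq> \<zero>" "x \<in> carrier M"
  obtains i where "x = i \<odot> m"
proof -
  interpret minimal_semimodule nat_semiring M by (fact assms(1))
  have "m \<in> range (\<lambda>i. i \<odot> m)"
    using assms(2) by (metis rangeI smult_nat_1)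
  then have "range (\<lambda>i. i \<odot> m) = carrier M"
    using minimal[OF subsemimodule_multiples[OF assms(2)]] assms(3) by auto
  then show ?thesis
    using that assms(4) by auto
qed

lemma two_elements_simple:
  assumes "carrier M = {\<zero>, a}" "a \<noteq> \<zero>"
  shows "minimal_semimodule nat_semiring M" "elementary_semimodule nat_semiring M"
proof -
  show "minimal_semimodule nat_semiring M"
  proof
    show "H = {\<zero>} \<or> H = carrier M" if "subsemimodule H nat_semiring M" for H
      using subsemimoduleD[OF that] assms by auto
  qed (use assms in auto)
  show "elementary_semimodule nat_semiring M"
  proof
    fix C assume "semimodule_congruence nat_semiring M C"
    then have "C \<subseteq> carrier M \<times> carrier M" "refl_on (carrier M) C" "sym C"
      by (auto simp: semimodule_congruence_def equiv_def)
    then show "C = Id_on (carrier M) \<or> C = carrier M \<times> carrier M"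
      using assms by (auto simp: refl_on_def dest: symD)
  qed (use assms in auto)
qed

text \<open>A non-zero element generates a minimal semimodule, and an idempotent \<open>e\<close> has no other
  multiples than \<open>0\<close> and \<open>e\<close>.\<close>

lemma idempotent_two_elements:
  assumes min: "minimal_semimodule nat_semiring M"
    and e: "e \<in> carrier M" "e \<noteq> \<zero>" "e \<oplus> e = e"
  shows "carrier M = {\<zero>, e}"
proof -
  have "i \<odot> e \<in> {\<zero>, e}" for i
    using e by (induction i) (auto simp: smult_nat_Suc)
  then show ?thesis
    using e minimal_generates[OF min e(1,2)] by (metis M.zero_closed empty_subsetI insert_iff
      insert_subset subsetI subset_antisym)
qed

text \<open>If \<open>m = 2km\<close>, then adding \<open>(2k - 2)m\<close> to both sides shows that \<open>(2k - 1)m\<close> is idempotent.\<close>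

lemma minimal_idempotent_or_torsion:
  assumes min: "minimal_semimodule nat_semiring M"
    and m: "m \<in> carrier M" "m \<noteq> \<zero>"
  obtains e where "e \<in> carrier M" "e \<noteq> \<zero>" "e \<oplus> e = e"
    | n where "n > 0" "n \<odot> m = \<zero>"
proof (cases "2 \<odot> m = \<zero>")
  case True
  then show ?thesis
    using that(2)[of 2] by simp
next
  case False
  then obtain k where k: "m = k \<odot> (2 \<odot> m)"
    using minimal_generates[OF min, of "2 \<odot> m" m] m by auto
  then have k0: "k > 0"
    using m by (cases "k = 0") auto
  define e where "e = (2 * k - 1) \<odot> m"
  have "(2 * k - 1) + (2 * k - 1) = k * 2 + (2 * k - 2)"
    using k0 by simp
  then have "e \<oplus> e = (k * 2 + (2 * k - 2)) \<odot> m"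
    unfolding e_def using m by (metis smult_nat_add)
  also have "\<dots> = m \<oplus> (2 * k - 2) \<odot> m"
    using m k by (simp add: smult_nat_add smult_nat_mult)
  also have "\<dots> = Suc (2 * k - 2) \<odot> m"
    using m by (simp add: smult_nat_Suc)
  also have "Suc (2 * k - 2) = 2 * k - 1"
    using k0 by simp
  finally have "e \<oplus> e = e"
    by (simp add: e_def)
  then show ?thesis
    using that(1)[of e] that(2)[of "2 * k - 1"] m k0 by (auto simp: e_def)
qed

text \<open>A congruence on a group that identifies \<open>x\<close> and \<open>y\<close> also identifies their difference with
  \<open>0\<close>, hence with it everything that this difference generates.\<close>

lemma minimal_imp_elementary:
  assumes min: "minimal_semimodule nat_semiring M"
  shows "elementary_semimodule nat_semiring M"
proof -
  interpret minimal_semimodule nat_semiring M by (fact min)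
  obtain m where m: "m \<in> carrier M" "m \<noteq> \<zero>"
    using nonzero M.zero_closed by blast
  \<comment> \<open>By idempotents or torsion, \<open>M\<close> has two elements or is a group.\<close>
  show ?thesis
  proof (rule minimal_idempotent_or_torsion[OF min m])
    fix e assume "e \<in> carrier M" "e \<noteq> \<zero>" "e \<oplus> e = e"
    then show ?thesis
      using idempotent_two_elements[OF min] two_elements_simple(2) by metis
  next
    fix n :: nat assume n: "n > 0" "n \<odot> m = \<zero>"
    have inverse: "\<exists>z\<in>carrier M. y \<oplus> z = \<zero>" if y: "y \<in> carrier M" for y
    proof -
      obtain i where i: "y = i \<odot> m"
        using minimal_generates[OF min m y] .
      have "y \<oplus> ((n - 1) * i) \<odot> m = (i + (n - 1) * i) \<odot> m"
        using m i by (simp add: smult_nat_add)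
      also have "i + (n - 1) * i = i * n"
        using n by (cases n) auto
      finally show ?thesis
        using m n by (auto simp: smult_nat_mult)
    qed
    show ?thesis
    proof
      fix C assume "semimodule_congruence nat_semiring M C"
      then have sub: "C \<subseteq> carrier M \<times> carrier M" and rf: "refl_on (carrier M) C"
        and sym: "sym C" and tr: "trans C"
        and add: "\<And>x y k. (x, y) \<in> C \<Longrightarrow> k \<in> carrier M \<Longrightarrow> (x \<oplus> k, y \<oplus> k) \<in> C"
        and smult: "\<And>x y i. (x, y) \<in> C \<Longrightarrow> (i \<odot> x, i \<odot> y) \<in> C"
        by (auto simp: semimodule_congruence_def equiv_def nat_semiring_def)
      show "C = Id_on (carrier M) \<or> C = carrier M \<times> carrier M"
      proof (cases "C \<subseteq> Id")
        case True
        then show ?thesis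
          using sub rf by (auto simp: refl_on_def)
      next
        case False
        then obtain x y where xy: "(x, y) \<in> C" "x \<noteq> y"
          by auto
        then have c: "x \<in> carrier M" "y \<in> carrier M"
          using sub by auto
        obtain z where z: "z \<in> carrier M" "y \<oplus> z = \<zero>"
          using inverse[OF c(2)] by blast
        define d where "d = x \<oplus> z"
        have d: "d \<in> carrier M" "(d, \<zero>) \<in> C"
          using add[OF xy(1) z(1)] c z by (auto simp: d_def)
        have "d \<oplus> y = x \<oplus> (y \<oplus> z)"
          using c z(1) by (simp add: d_def M.a_ac)
        also have "\<dots> = x"
          using c z(2) by simp
        finally have "d \<oplus> y = x" .
        then have "d \<noteq> \<zero>"
          using c xy by auto
        then have "(w, \<zero>) \<in> C" if "w \<in> carrier M" for w
          using minimal_generates[OF min d(1) _ that] smult[OF d(2)] by (metis smult_nat_zero)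
        then show ?thesis
          using sub sym tr by (blast dest: symD transD)
      qed
    qed
  qed
qed

text \<open>Invertibility of \<open>x + k\<close> means invertibility of both \<open>x\<close> and \<open>k\<close>, so splitting \<open>M\<close> into
  invertible and non-invertible elements is a congruence.\<close>

lemma elementary_two_elements_or_group:
  assumes "elementary_semimodule nat_semiring M"
  obtains a where "carrier M = {\<zero>, a}" "a \<noteq> \<zero>"
    | "\<And>x. x \<in> carrier M \<Longrightarrow> \<exists>y\<in>carrier M. x \<oplus> y = \<zero>"
proof -
  interpret elementary_semimodule nat_semiring M by (fact assms)
  define U where "U x \<longleftrightarrow> (\<exists>y\<in>carrier M. x \<oplus> y = \<zero>)" for x
  have U0: "U \<zero>"
    by (auto simp: U_def)
  have U_add: "U (x \<oplus> k) \<longleftrightarrow> U x \<and> U k" if c: "x \<in> carrier M" "k \<in> carrier M" for x k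
  proof
    assume "U (x \<oplus> k)"
    then obtain y where y: "y \<in> carrier M" "x \<oplus> k \<oplus> y = \<zero>"
      by (auto simp: U_def)
    then have "x \<oplus> (k \<oplus> y) = \<zero>" "k \<oplus> (x \<oplus> y) = \<zero>"
      using c by (auto simp: M.a_ac)
    then show "U x \<and> U k"
      using c y by (auto simp: U_def)
  next
    assume "U x \<and> U k"
    then obtain y z where y: "y \<in> carrier M" "x \<oplus> y = \<zero>" and z: "z \<in> carrier M" "k \<oplus> z = \<zero>"
      by (auto simp: U_def)
    have "x \<oplus> k \<oplus> (y \<oplus> z) = (x \<oplus> y) \<oplus> (k \<oplus> z)"
      using c y(1) z(1) by (simp add: M.a_ac)
    then show "U (x \<oplus> k)"
      using y z by (auto simp: U_def)
  qed
  define C where "C = {(x, y). x \<in> carrier M \<and> y \<in> carrier M \<and> (U x \<longleftrightarrow> U y)}"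
  have "semimodule_congruence nat_semiring M C"
    by (rule translation_invariant_imp_congruence)
      (auto simp: C_def U_add equiv_def refl_on_def sym_def trans_def)
  then have "C = Id_on (carrier M) \<or> C = carrier M \<times> carrier M"
    by (rule elementary)
  then show ?thesis
  proof
    assume Id: "C = Id_on (carrier M)"
    obtain a where a: "a \<in> carrier M" "a \<noteq> \<zero>"
      using nonzero M.zero_closed by blast
    have eq: "x = y" if "x \<in> carrier M" "y \<in> carrier M" "U x = U y" for x y
      using that Id by (auto simp: C_def)
    have "\<not> U a"
      using eq[OF a(1) M.zero_closed] a U0 by auto
    then have "x = \<zero> \<or> x = a" if "x \<in> carrier M" for x
      using that eq[OF that M.zero_closed] eq[OF that a(1)] U0 by blast
    then show ?thesis
      using that(1)[of a] a by auto
  next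
    assume "C = carrier M \<times> carrier M"
    then have "U x" if "x \<in> carrier M" for x
      using that U0 M.zero_closed unfolding C_def by blast
    then show ?thesis
      using that(2) by (auto simp: U_def)
  qed
qed

text \<open>The congruence \<open>\<exists>h h'\<in>H. x + h = y + h'\<close> identifies the elements of \<open>H\<close> with \<open>0\<close>. Since
  \<open>H\<close> is non-zero and \<open>M\<close> is elementary, it must then identify every \<open>x\<close> with \<open>0\<close>.\<close>

lemma elementary_difference:
  assumes "elementary_semimodule nat_semiring M" and H: "subsemimodule H nat_semiring M"
    and g: "g \<in> H" "g \<noteq> \<zero>" and x: "x \<in> carrier M"
  obtains h h' where "h \<in> H" "h' \<in> H" "x \<oplus> h = h'"
proof -
  interpret elementary_semimodule nat_semiring M by (fact assms(1))
  note D = subsemimoduleD(1-3)[OF H]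
  have H_carrier: "h \<in> carrier M" if "h \<in> H" for h
    using that D(1) by auto
  define C where
    "C = {(x, y). x \<in> carrier M \<and> y \<in> carrier M \<and> (\<exists>h\<in>H. \<exists>h'\<in>H. x \<oplus> h = y \<oplus> h')}"
  have "semimodule_congruence nat_semiring M C"
  proof (rule translation_invariant_imp_congruence)
    have "trans C"
    proof (rule transI)
      fix x y z assume "(x, y) \<in> C" "(y, z) \<in> C"
      then obtain a b c d where c: "x \<in> carrier M" "y \<in> carrier M" "z \<in> carrier M"
        and h: "a \<in> H" "b \<in> H" "c \<in> H" "d \<in> H"
        and eq: "x \<oplus> a = y \<oplus> b" "y \<oplus> c = z \<oplus> d"
        by (auto simp: C_def)
      note hc = h[THEN H_carrier]
      have "x \<oplus> (a \<oplus> c) = (x \<oplus> a) \<oplus> c"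
        using c hc by (simp add: M.a_assoc)
      also have "\<dots> = (y \<oplus> c) \<oplus> b"
        unfolding eq(1) using c hc by (simp add: M.a_ac)
      also have "\<dots> = z \<oplus> (d \<oplus> b)"
        unfolding eq(2) using c hc by (simp add: M.a_assoc)
      finally show "(x, z) \<in> C"
        using c h D(3) by (auto simp: C_def)
    qed
    moreover have "refl_on (carrier M) C"
      using D(2) by (auto simp: C_def refl_on_def)
    moreover have "sym C"
      by (rule symI) (auto simp: C_def, metis)
    ultimately show "equiv (carrier M) C"
      by (auto simp: equiv_def C_def)
  next
    fix x y k assume "(x, y) \<in> C" and k: "k \<in> carrier M"
    then obtain a b where c: "x \<in> carrier M" "y \<in> carrier M"
      and h: "a \<in> H" "b \<in> H" and eq: "x \<oplus> a = y \<oplus> b"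
      by (auto simp: C_def)
    note hc = h[THEN H_carrier]
    have "x \<oplus> k \<oplus> a = (x \<oplus> a) \<oplus> k"
      using c hc k by (simp add: M.a_ac)
    also have "\<dots> = y \<oplus> k \<oplus> b"
      unfolding eq using c hc k by (simp add: M.a_ac)
    finally show "(x \<oplus> k, y \<oplus> k) \<in> C"
      using c h k by (auto simp: C_def)
  qed
  then have "C = Id_on (carrier M) \<or> C = carrier M \<times> carrier M"
    by (rule elementary)
  moreover have "(g, \<zero>) \<in> C"
    using g D(2) H_carrier by (force simp: C_def)
  ultimately have "(x, \<zero>) \<in> C"
    using g x by auto
  then show ?thesis
    using that H_carrier by (auto simp: C_def)
qed

lemma group_left_cancel:
  assumes "\<exists>v\<in>carrier M. z \<oplus> v = \<zero>" "x \<in> carrier M" "y \<in> carrier M" "z \<in> carrier M"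
    and eq: "z \<oplus> x = z \<oplus> y"
  shows "x = y"
proof -
  obtain v where v: "v \<in> carrier M" "z \<oplus> v = \<zero>"
    using assms(1) by blast
  have "w = v \<oplus> (z \<oplus> w)" if "w \<in> carrier M" for w
    using that v assms(4) by (simp add: M.a_comm flip: M.a_assoc)
  then show ?thesis
    using assms by metis
qed

text \<open>If \<open>2g \<noteq> 0\<close>, then \<open>elementary_difference\<close> for the submonoid of multiples of \<open>2g\<close> yields
  \<open>g + 2ig = 2jg\<close>. The coefficients on the two sides have different parity, so cancelling leaves a
  positive multiple of \<open>g\<close> that vanishes.\<close>

lemma elementary_group_torsion:
  assumes elem: "elementary_semimodule nat_semiring M"
    and group: "\<And>x. x \<in> carrier M \<Longrightarrow> \<exists>y\<in>carrier M. x \<oplus> y = \<zero>"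
    and g: "g \<in> carrier M"
  obtains n where "n > 0" "n \<odot> g = \<zero>"
proof (cases "2 \<odot> g = \<zero>")
  case True
  then show ?thesis
    using that[of 2] by simp
next
  case False
  have cancel: "\<exists>n>0. n \<odot> g = \<zero>" if "a \<odot> g = b \<odot> g" "a < b" for a b
  proof -
    have "a \<odot> g \<oplus> (b - a) \<odot> g = b \<odot> g"
      using that(2) g by (simp flip: smult_nat_add)
    then have "a \<odot> g \<oplus> (b - a) \<odot> g = a \<odot> g \<oplus> \<zero>"
      using that(1) g by simp
    then have "(b - a) \<odot> g = \<zero>"
      using group_left_cancel[of "a \<odot> g" "(b - a) \<odot> g" \<zero>] group g by auto
    then show ?thesis
      using that by (metis zero_less_diff)
  qed
  have sub: "subsemimodule (range (\<lambda>i. i \<odot> (2 \<odot> g))) nat_semiring M"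
    using g by (intro subsemimodule_multiples) simp
  have "2 \<odot> g \<in> range (\<lambda>i. i \<odot> (2 \<odot> g))"
    using g by (metis rangeI smult_nat_1 smult_nat_closed)
  then obtain h h' where h: "h \<in> range (\<lambda>i. i \<odot> (2 \<odot> g))" "h' \<in> range (\<lambda>i. i \<odot> (2 \<odot> g))"
    and eq: "g \<oplus> h = h'"
    by (rule elementary_difference[OF elem sub _ False g])
  then obtain i j where "g \<oplus> i \<odot> (2 \<odot> g) = j \<odot> (2 \<odot> g)"
    by auto
  then have "Suc (i * 2) \<odot> g = (j * 2) \<odot> g"
    using g by (simp add: smult_nat_Suc smult_nat_mult)
  moreover have "Suc (i * 2) \<noteq> j * 2"
    by presburger
  ultimately show ?thesis
    using cancel that by (metis nat_neq_iff)
qed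

text \<open>In a group, differences of elements of \<open>H\<close> exhaust \<open>M\<close>, and they lie in \<open>H\<close> because the inverse
  of an element of finite order is one of its multiples.\<close>

lemma elementary_imp_minimal:
  assumes elem: "elementary_semimodule nat_semiring M"
  shows "minimal_semimodule nat_semiring M"
proof -
  interpret elementary_semimodule nat_semiring M by (fact elem)
  show ?thesis
  proof (rule elementary_two_elements_or_group[OF elem])
    fix a assume "carrier M = {\<zero>, a}" "a \<noteq> \<zero>"
    then show ?thesis
      by (rule two_elements_simple(1))
  next
    assume group: "\<And>x. x \<in> carrier M \<Longrightarrow> \<exists>y\<in>carrier M. x \<oplus> y = \<zero>"
    show ?thesis
    proof
      fix H assume H: "subsemimodule H nat_semiring M"
      note D = subsemimoduleD[OF H]
      show "H = {\<zero>} \<or> H = carrier M"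
      proof (cases "H = {\<zero>}")
        case False
        then obtain g where g: "g \<in> H" "g \<noteq> \<zero>"
          using D(2) by blast
        have "x \<in> H" if x: "x \<in> carrier M" for x
        proof -
          obtain h h' where h: "h \<in> H" "h' \<in> H" "x \<oplus> h = h'"
            using elementary_difference[OF elem H g x] .
          then have hc: "h \<in> carrier M"
            using D(1) by auto
          obtain n where n: "n > 0" "n \<odot> h = \<zero>"
            using elementary_group_torsion[OF elem group hc] .
          have "h' \<oplus> (n - 1) \<odot> h = x \<oplus> (h \<oplus> (n - 1) \<odot> h)"
            using x hc h(3) by (auto simp: M.a_assoc)
          also have "h \<oplus> (n - 1) \<odot> h = \<zero>"
            using n hc by (simp flip: smult_nat_Suc)
          finally have "x = h' \<oplus> (n - 1) \<odot> h"
            using x by simp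
          then show ?thesis
            using h D(3,4) by (simp add: nat_semiring_def)
        qed
        then show ?thesis
          using D(1) by auto
      qed simp
    qed
  qed
qed


section \<open>Classification of the minimal semimodules\<close>

lemma idempotent_isomorphic_B:
  assumes "carrier M = {\<zero>, e}" "e \<noteq> \<zero>" "e \<oplus> e = e"
  shows "semimodule_isomorphic nat_semiring M B_semimodule"
proof -
  define h where "h x = (if x = \<zero> then 0 else 1 :: nat)" for x
  have e: "e \<in> carrier M"
    using assms by auto
  interpret B: nat_module B_semimodule
    by (rule nat_module.intro) (rule semimodule_B)
  have B: "carrier B_semimodule = {0, 1}" "\<zero>\<^bsub>B_semimodule\<^esub> = 0"
    "\<And>x y. x \<oplus>\<^bsub>B_semimodule\<^esub> y = max x y"
    by (auto simp: B_semimodule_def nat_semimodule_def boolean_semiring_def)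
  have add: "h (x \<oplus> y) = h x \<oplus>\<^bsub>B_semimodule\<^esub> h y" if "x \<in> carrier M" "y \<in> carrier M" for x y
    using that assms e by (auto simp: h_def B)
  have "h (i \<odot> x) = i \<odot>\<^bsub>B_semimodule\<^esub> h x" if "x \<in> carrier M" for i x
  proof (induction i)
    case 0
    then show ?case
      using that by (simp add: h_def B B.smult_nat_0)
  next
    case (Suc i)
    then show ?case
      using that add by (simp add: h_def B smult_nat_Suc B.smult_nat_Suc)
  qed
  then have "h \<in> semimodule_hom nat_semiring M B_semimodule"
    using add by (auto simp: semimodule_hom_def hom_def) (auto simp: h_def B)
  moreover have "bij_betw h (carrier M) (carrier B_semimodule)"
    using assms by (auto simp: bij_betw_def inj_on_def h_def B)
  ultimately show ?thesis
    by (auto simp: semimodule_isomorphic_def)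
qed

end

lemma Z_semimodule_simps:
  assumes "p > 1"
  shows "carrier (Z_semimodule p) = {0..<int p}" "\<zero>\<^bsub>Z_semimodule p\<^esub> = 0"
    and "\<And>x y. x \<oplus>\<^bsub>Z_semimodule p\<^esub> y = (x + y) mod int p"
    and "\<And>i x. x \<in> {0..<int p} \<Longrightarrow> i \<odot>\<^bsub>Z_semimodule p\<^esub> x = (int i * x) mod int p"
proof -
  show carrier: "carrier (Z_semimodule p) = {0..<int p}" and zero: "\<zero>\<^bsub>Z_semimodule p\<^esub> = 0"
    and add: "\<And>x y. x \<oplus>\<^bsub>Z_semimodule p\<^esub> y = (x + y) mod int p"
    by (auto simp: Z_semimodule_def nat_semimodule_def residue_ring_def)
  interpret Z: nat_module "Z_semimodule p"
    by (rule nat_module.intro) (rule semimodule_Z[OF assms])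
  show "i \<odot>\<^bsub>Z_semimodule p\<^esub> x = (int i * x) mod int p" if "x \<in> {0..<int p}" for i x
  proof (induction i)
    case (Suc i)
    have "Suc i \<odot>\<^bsub>Z_semimodule p\<^esub> x = (x + (int i * x) mod int p) mod int p"
      using that Suc carrier by (simp add: Z.smult_nat_Suc add)
    then show ?case
      by (simp add: mod_simps algebra_simps)
  qed (use that carrier zero Z.smult_nat_0 in auto)
qed

context nat_module
begin

text \<open>The least positive \<open>p\<close> with \<open>pm = 0\<close> is the order of the cyclic group \<open>M\<close>. If \<open>p = ab\<close> with
  \<open>a < p\<close>, then \<open>am \<noteq> 0\<close> generates \<open>m\<close>, and \<open>m = kam\<close> gives \<open>bm = kpm = 0\<close>, so \<open>b = p\<close>.\<close>

lemma torsion_isomorphic_Z: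
  assumes min: "minimal_semimodule nat_semiring M"
    and m: "m \<in> carrier M" "m \<noteq> \<zero>" and n: "n > 0" "n \<odot> m = \<zero>"
  obtains p where "prime p" "semimodule_isomorphic nat_semiring M (Z_semimodule p)"
proof -
  define p where "p = (LEAST p. p > 0 \<and> p \<odot> m = \<zero>)"
  have p: "p > 0" "p \<odot> m = \<zero>"
    using LeastI[of "\<lambda>p. p > 0 \<and> p \<odot> m = \<zero>" n] n by (auto simp: p_def)
  have least: "i \<odot> m \<noteq> \<zero>" if "0 < i" "i < p" for i
    using not_less_Least[of i "\<lambda>p. p > 0 \<and> p \<odot> m = \<zero>"] that by (auto simp: p_def)
  have "p \<noteq> 1"
    using p m by auto
  then have p1: "p > 1"
    using p by simp
  have mod_p: "(i mod p) \<odot> m = i \<odot> m" for i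
  proof -
    have "i \<odot> m = (i div p * p + i mod p) \<odot> m"
      by simp
    also have "\<dots> = (i mod p) \<odot> m"
      using m p by (simp only: smult_nat_add smult_nat_mult) simp
    finally show ?thesis ..
  qed
  have "prime p"
    unfolding prime_nat_iff
  proof (intro conjI allI impI)
    \<comment> \<open>The roles of \<open>a\<close> and \<open>b\<close> are asymmetric: either \<open>am = 0\<close>, and then \<open>a = p\<close>, or \<open>am\<close>
      generates \<open>m\<close>, and then \<open>b = p\<close>.\<close>
    fix a assume "a dvd p"
    then obtain b where ab: "p = a * b"
      by (auto elim: dvdE)
    then have pos: "0 < a" "0 < b" "b \<le> p"
      using p by auto
    show "a = 1 \<or> a = p"
    proof (cases "a \<odot> m = \<zero>")
      case True
      then show ?thesis
        using least[of a] pos ab p by (metis dvd_imp_le dvd_triv_left le_neq_implies_less)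
    next
      case False
      then obtain k where k: "m = k \<odot> (a \<odot> m)"
        using minimal_generates[OF min, of "a \<odot> m" m] m by auto
      have "b \<odot> m = (b * (k * a)) \<odot> m"
        using k m by (simp add: smult_nat_mult)
      also have "\<dots> = (k * p) \<odot> m"
        by (simp add: ab ac_simps)
      also have "\<dots> = \<zero>"
        using m p by (simp add: smult_nat_mult)
      finally have "b = p"
        using least[of b] pos by force
      then show ?thesis
        using ab p by simp
    qed
  qed (rule p1)
  define g where "g i = nat i \<odot> m" for i :: int
  have g_mod: "g (i mod int p) = g i" if "i \<ge> 0" for i
    using that mod_p[of "nat i"] by (simp add: g_def nat_mod_distrib)
  note Z = Z_semimodule_simps[OF p1]
  have "g \<in> semimodule_hom nat_semiring (Z_semimodule p) M"
    unfolding semimodule_hom_def hom_def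
    using m by (auto simp: Z g_mod) (auto simp: g_def nat_add_distrib nat_mult_distrib
      smult_nat_add smult_nat_mult)
  moreover have "inj_on g {0..<int p}"
  proof (rule linorder_inj_onI)
    fix i j assume ij: "i < j" "i \<in> {0..<int p}" "j \<in> {0..<int p}"
    show "g i \<noteq> g j"
    proof
      assume "g i = g j"
      then have "nat i \<odot> m \<oplus> (p - nat j) \<odot> m = nat j \<odot> m \<oplus> (p - nat j) \<odot> m"
        by (simp add: g_def)
      then have "(nat i + (p - nat j)) \<odot> m = \<zero>"
        using m ij p by (simp flip: smult_nat_add)
      moreover have "(nat i + (p - nat j)) \<odot> m \<noteq> \<zero>"
        by (rule least) (use ij in auto)
      ultimately show False
        by contradiction
    qed
  qed auto
  moreover have "g ` {0..<int p} = carrier M"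
  proof
    show "carrier M \<subseteq> g ` {0..<int p}"
    proof
      fix x assume "x \<in> carrier M"
      then obtain i where "x = i \<odot> m"
        using minimal_generates[OF min m] by blast
      then have "x = g (int (i mod p))"
        by (simp add: g_def mod_p)
      then show "x \<in> g ` {0..<int p}"
        using p by (intro image_eqI) auto
    qed
  qed (use m in \<open>auto simp: g_def\<close>)
  ultimately have "semimodule_isomorphic nat_semiring (Z_semimodule p) M"
    by (auto simp: semimodule_isomorphic_def bij_betw_def Z)
  then show ?thesis
    using that \<open>prime p\<close> semimodule_isomorphic_sym[OF semimodule_Z[OF p1]] by blast
qed

end

lemma minimal_B: "minimal_semimodule nat_semiring B_semimodule"
proof -
  interpret B: nat_module B_semimodule
    by (rule nat_module.intro) (rule semimodule_B)
  show ?thesis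
    by (rule B.two_elements_simple(1)[of 1])
      (auto simp: B_semimodule_def nat_semimodule_def boolean_semiring_def)
qed

text \<open>A non-zero residue \<open>m\<close> has an inverse \<open>u\<close> modulo \<open>p\<close>, so every residue \<open>x\<close> is the multiple
  \<open>(ux)m\<close> of it.\<close>

lemma minimal_Z:
  assumes "prime p"
  shows "minimal_semimodule nat_semiring (Z_semimodule p)"
proof -
  have p1: "p > 1"
    using assms by (rule prime_gt_1_nat)
  interpret semimodule nat_semiring "Z_semimodule p"
    by (rule semimodule_Z[OF p1])
  note Z = Z_semimodule_simps[OF p1]
  show ?thesis
  proof
    show "carrier (Z_semimodule p) \<noteq> {\<zero>\<^bsub>Z_semimodule p\<^esub>}"
      using p1 by (auto simp: Z set_eq_iff intro!: exI[of _ 1])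
  next
    fix H assume H: "subsemimodule H nat_semiring (Z_semimodule p)"
    note D = subsemimoduleD[OF H, unfolded Z]
    show "H = {\<zero>\<^bsub>Z_semimodule p\<^esub>} \<or> H = carrier (Z_semimodule p)"
    proof (cases "H = {0}")
      case False
      then obtain m where m: "m \<in> H" "m \<noteq> 0"
        using D(2) by blast
      then have range: "m \<in> {0..<int p}"
        using D(1) by auto
      then have "\<not> int p dvd m"
        using m zdvd_not_zless[of m "int p"] by auto
      then have "coprime m (int p)"
        using assms prime_imp_coprime[of "int p" m] by (auto simp: coprime_commute)
      then obtain u where u: "[m * u = 1] (mod int p)"
        using cong_solve_coprime_int by blast
      have "x \<in> H" if x: "x \<in> {0..<int p}" for x
      proof -
        define i where "i = nat ((u * x) mod int p)"
        have "int i * m mod int p = ((u * x) mod int p) * m mod int p"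
          using p1 by (simp add: i_def)
        also have "\<dots> = (m * u) * x mod int p"
          by (simp add: mod_simps algebra_simps)
        also have "\<dots> = ((m * u) mod int p) * x mod int p"
          by (simp add: mod_simps)
        also have "\<dots> = x"
          using u x p1 by (simp add: cong_def)
        finally show ?thesis
          using D(4)[of i m] m range by (simp add: Z nat_semiring_def)
      qed
      then show ?thesis
        using D(1) by (auto simp: Z)
    qed (simp add: Z)
  qed
qed

lemma minimal_iff_isomorphic:
  assumes "semimodule nat_semiring M"
  shows "minimal_semimodule nat_semiring M \<longleftrightarrow>
    semimodule_isomorphic nat_semiring M B_semimodule \<or>
    (\<exists>p. prime p \<and> semimodule_isomorphic nat_semiring M (Z_semimodule p))"
proof
  interpret nat_module M
    by (rule nat_module.intro) (rule assms)
  assume min: "minimal_semimodule nat_semiring M"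
  interpret minimal_semimodule nat_semiring M by (fact min)
  obtain m where m: "m \<in> carrier M" "m \<noteq> \<zero>\<^bsub>M\<^esub>"
    using nonzero M.zero_closed by blast
  show "semimodule_isomorphic nat_semiring M B_semimodule \<or>
    (\<exists>p. prime p \<and> semimodule_isomorphic nat_semiring M (Z_semimodule p))"
  proof (rule minimal_idempotent_or_torsion[OF min m])
    fix e assume e: "e \<in> carrier M" "e \<noteq> \<zero>\<^bsub>M\<^esub>" "e \<oplus>\<^bsub>M\<^esub> e = e"
    show ?thesis
      using idempotent_isomorphic_B[OF idempotent_two_elements[OF min e] e(2,3)] by simp
  next
    fix n :: nat assume n: "n > 0" "n \<odot>\<^bsub>M\<^esub> m = \<zero>\<^bsub>M\<^esub>"
    obtain p where "prime p" "semimodule_isomorphic nat_semiring M (Z_semimodule p)"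
      using torsion_isomorphic_Z[OF min m n] .
    then show ?thesis
      by blast
  qed
next
  assume "semimodule_isomorphic nat_semiring M B_semimodule \<or>
    (\<exists>p. prime p \<and> semimodule_isomorphic nat_semiring M (Z_semimodule p))"
  then show "minimal_semimodule nat_semiring M"
    using minimal_semimodule_isomorphic[OF assms minimal_B]
      minimal_semimodule_isomorphic[OF assms minimal_Z] by auto
qed

theorem theorem4p3:
  fixes M :: "(nat, 'b, 'm) module_scheme"
  assumes "semimodule nat_semiring M"
  shows "(minimal_semimodule nat_semiring M \<longleftrightarrow> elementary_semimodule nat_semiring M) \<and>
    (elementary_semimodule nat_semiring M \<longleftrightarrow> simple_semimodule nat_semiring M) \<and>
    (simple_semimodule nat_semiring M \<longleftrightarrow>
      semimodule_isomorphic nat_semiring M B_semimodule \<or>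
      (\<exists>p::nat. prime p \<and> semimodule_isomorphic nat_semiring M (Z_semimodule p)))"
proof -
  interpret nat_module M
    by (rule nat_module.intro) (rule assms)
  have "minimal_semimodule nat_semiring M \<longleftrightarrow> elementary_semimodule nat_semiring M"
    using minimal_imp_elementary elementary_imp_minimal by blast
  moreover have "simple_semimodule nat_semiring M \<longleftrightarrow>
      minimal_semimodule nat_semiring M \<and> elementary_semimodule nat_semiring M"
    by (auto simp: simple_semimodule_def)
  ultimately show ?thesis
    using minimal_iff_isomorphic[OF assms] by blast
qed

end
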